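(* Let $N\ge 1$, $\Omega\subset\mathbb{R}^N$ a domain, $p>1$ and $q=\frac{2p}{p+1}$. Put $$M_\dagger:=\left(\frac{p-1}{p+1}\right)^{\frac{p-1}{p+1}}\left(\frac{N(p+1)^2}{4p}\right)^{\frac{p}{p+1}} .$$ For any $M>M_\dagger$ and any $\nu>0$ such that $(1-\nu)M>M_\dagger$, there exists a positive constant $c_{N,p,\nu}$, depending only on $N,p,\nu$, such that any positive solution $u$ of $$-\Delta u=|u|^{p-1}u+M|\nabla u|^q\quad\text{in }\Omega$$ satisfies $$|\nabla u(x)|\le c_{N,p,\nu}\big((1-\nu)M-M_\dagger\big)^{-\frac{p+1}{p-1}}\big(\mathrm{dist}(x,\partial\Omega)\big)^{-\frac{p+1}{p-1}}\qquad\text{for all }x\in\Omega .$$ Consequently, for $M>M_\dagger$ there exists no nontrivial nonnegative solution of the equation in $\mathbb{R}^N$.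
   Context: Solutions are classical ($C^2$). A domain is a connected open set. In the estimate $\partial\Omega\neq\emptyset$; the case of the whole space is the last assertion. Nontrivial means not identically zero. *)

theory Defs
  imports "HOL-Analysis.Analysis"
begin

definition partial_deriv :: "'n::finite \<Rightarrow> (real ^ 'n \<Rightarrow> real) \<Rightarrow> real ^ 'n \<Rightarrow> real" where
  "partial_deriv i u x = frechet_derivative u (at x) (axis i 1)"

definition gradient :: "(real ^ 'n::finite \<Rightarrow> real) \<Rightarrow> real ^ 'n \<Rightarrow> real ^ 'n" where
  "gradient u x = (\<chi> i. partial_deriv i u x)"

definition laplacian :: "(real ^ 'n::finite \<Rightarrow> real) \<Rightarrow> real ^ 'n \<Rightarrow> real" where
  "laplacian u x = (\<Sum>i\<in>UNIV. partial_deriv i (partial_deriv i u) x)"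

(* Meant for open S only: partial_deriv takes the full derivative at x, so the values of u
   outside S are irrelevant.  Continuity of u and of its first partial derivatives follows
   from their differentiability. *)
definition C2_on :: "(real ^ 'n::finite) set \<Rightarrow> (real ^ 'n \<Rightarrow> real) \<Rightarrow> bool" where
  "C2_on S u \<longleftrightarrow>
     u differentiable_on S \<and>
     (\<forall>i. partial_deriv i u differentiable_on S) \<and>
     (\<forall>i j. continuous_on S (partial_deriv j (partial_deriv i u)))"

definition classical_solution ::
    "real \<Rightarrow> real \<Rightarrow> real \<Rightarrow> (real ^ 'n::finite) set \<Rightarrow> (real ^ 'n \<Rightarrow> real) \<Rightarrow> bool" where
  "classical_solution p q M \<Omega> u \<longleftrightarrow>
     C2_on \<Omega> u \<and>
     (\<forall>x\<in>\<Omega>. - laplacian u x =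
        \<bar>u x\<bar> powr (p - 1) * u x + M * norm (gradient u x) powr q)"

definition M_dagger :: "nat \<Rightarrow> real \<Rightarrow> real" where
  "M_dagger N p =
     ((p - 1) / (p + 1)) powr ((p - 1) / (p + 1)) *
     (real N * (p + 1)\<^sup>2 / (4 * p)) powr (p / (p + 1))"

end

theory Submission
  imports Defs "HOL-Real_Asymp.Real_Asymp"
begin

text \<open>
  Bernstein's method.  By Bochner's formula, the Cauchy--Schwarz bound
  $|D^2u|^2 \ge (\Delta u)^2/N$ and Young's inequality, which produces exactly the constant
  $M_\dagger$, the function $z = |\nabla u|^2$ satisfies
  $\Delta z \ge \frac{2}{N}(M^2 - M_\dagger^2) z^q - qM z^{(q-1)/2} |\nabla z|$ where $z > 0$.
  Evaluating this at a maximum point of $z\,(R^2 - |x-a|^2)^{2/(q-1)}$ in the ball $B_R(a)$ bounds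
  $|\nabla u(a)|$ by a multiple of $R^{-1/(q-1)}$.

  Since $u$ is only $C^2$, the function $z$ need not be twice differentiable.  Instead of invoking
  elliptic regularity, $z$ is replaced by the sum $z_h$ of the squared difference quotients
  of $u$: it is $C^2$, and $\Delta z_h$ converges locally uniformly to the right-hand side of
  Bochner's formula, which is all that the maximum principle needs.
\<close>

subsection \<open>Derivatives along coordinate axes\<close>

text \<open>A relation on one-variable restrictions rather than a Frechet derivative: sums,
  products, compositions and translates inherit it directly from the \<open>DERIV\<close> rules, and
  the maximum principle only tests along coordinate lines.\<close>

definition has_axis_deriv :: "(real ^ 'n::finite \<Rightarrow> real) \<Rightarrow> real \<Rightarrow> 'n \<Rightarrow> real ^ 'n \<Rightarrow> bool" where
  "has_axis_deriv f D i x \<longleftrightarrow> ((\<lambda>t. f (x + t *\<^sub>R axis i 1)) has_real_derivative D) (at 0)"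

lemma has_axis_deriv_line:
  assumes "has_axis_deriv f D i (x + t *\<^sub>R axis i 1)"
  shows "((\<lambda>t. f (x + t *\<^sub>R axis i 1)) has_real_derivative D) (at t)"
proof -
  have "f (x + t *\<^sub>R axis i 1 + s *\<^sub>R axis i 1) = f (x + (s + t) *\<^sub>R axis i 1)" for s
    by (simp add: algebra_simps)
  with assms DERIV_shift[of "\<lambda>t. f (x + t *\<^sub>R axis i 1)" D 0 t] show ?thesis
    by (simp add: has_axis_deriv_def)
qed

lemma has_axis_deriv_partial_deriv:
  assumes "f differentiable (at x)"
  shows "has_axis_deriv f (partial_deriv i f x) i x"
proof -
  have "(f has_derivative frechet_derivative f (at x)) (at (x + 0 *\<^sub>R axis i 1))"
    using frechet_derivative_works[of f "at x"] assms by simp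
  moreover have "((\<lambda>t. x + t *\<^sub>R axis i 1) has_derivative (\<lambda>t. t *\<^sub>R axis i 1)) (at (0::real))"
    by (auto intro!: derivative_eq_intros)
  ultimately have "((\<lambda>t. f (x + t *\<^sub>R axis i 1)) has_derivative
      (\<lambda>t. frechet_derivative f (at x) (t *\<^sub>R axis i 1))) (at 0)"
    using has_derivative_compose by fastforce
  moreover have "frechet_derivative f (at x) (t *\<^sub>R axis i 1) = partial_deriv i f x * t" for t
    using linear_frechet_derivative[OF assms] by (simp add: partial_deriv_def linear_cmul)
  ultimately show ?thesis
    by (simp add: has_axis_deriv_def has_field_derivative_def)
qed

section \<open>Difference quotients and their locally uniform convergence\<close>

definition diff_quot :: "'n \<Rightarrow> real \<Rightarrow> (real ^ 'n::finite \<Rightarrow> real) \<Rightarrow> real ^ 'n \<Rightarrow> real" where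
  "diff_quot i h f x = (f (x + h *\<^sub>R axis i 1) - f x) / h"

lemma dist_axis_step:
  fixes x y :: "real ^ 'n::finite"
  shows "dist (x + t *\<^sub>R axis i 1) y \<le> dist x y + \<bar>t\<bar>"
proof -
  have "norm (x + t *\<^sub>R axis i 1 - y) \<le> norm (x - y) + norm (t *\<^sub>R (axis i 1 :: real^'n))"
    by (metis add_diff_eq add.commute diff_add_eq norm_triangle_ineq)
  then show ?thesis by (simp add: dist_norm)
qed

text \<open>By the mean value theorem the quotient equals \<open>g\<close> at an intermediate point,
  which is close to \<open>x0\<close> when \<open>h\<close> is small and \<open>x\<close> is near
  \<open>x0\<close>. The product filter makes \<open>h\<close> and \<open>x\<close> vary jointly;
  this is the locally uniform convergence used for passing to limits along moving points.\<close>

lemma diff_quot_tendsto: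
  fixes f :: "real ^ 'n::finite \<Rightarrow> real"
  assumes "open S" "x0 \<in> S"
    and der: "\<And>y. y \<in> S \<Longrightarrow> has_axis_deriv f (g y) i y"
    and cont: "isCont g x0"
  shows "((\<lambda>(h, x). diff_quot i h f x) \<longlongrightarrow> g x0) (at_right 0 \<times>\<^sub>F nhds x0)"
proof (rule tendstoI)
  fix e :: real assume "e > 0"
  have "\<forall>\<^sub>F y in nhds x0. dist (g y) (g x0) < e"
    using cont \<open>e > 0\<close> unfolding continuous_at tendsto_at_iff_tendsto_nhds by (rule tendstoD)
  moreover have "\<forall>\<^sub>F y in nhds x0. y \<in> S"
    using assms by (simp add: eventually_nhds_in_open)
  ultimately have "\<forall>\<^sub>F y in nhds x0. y \<in> S \<and> dist (g y) (g x0) < e"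
    by eventually_elim simp
  then obtain r where "r > 0" and r: "\<And>y. dist y x0 < r \<Longrightarrow> y \<in> S \<and> dist (g y) (g x0) < e"
    by (auto simp: eventually_nhds_metric)
  \<comment> \<open>Half of \<open>r\<close> is allotted to \<open>x\<close> and half to
    \<open>h\<close>, so the whole segment from \<open>x\<close> to the translated point stays
    within \<open>r\<close> of \<open>x0\<close>.\<close>
  have "dist (diff_quot i h f x) (g x0) < e" if h: "0 < h" "h < r / 2" and x: "dist x x0 < r / 2" for h x
  proof -
    have near: "dist (x + t *\<^sub>R axis i 1) x0 < r" if "0 \<le> t" "t \<le> h" for t
      using dist_axis_step[of x t i x0] that h x by simp
    have "((\<lambda>t. f (x + t *\<^sub>R axis i 1)) has_real_derivative g (x + t *\<^sub>R axis i 1)) (at t)"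
      if "0 \<le> t" "t \<le> h" for t
      using has_axis_deriv_line der r near that by blast
    with MVT2[OF h(1), of "\<lambda>t. f (x + t *\<^sub>R axis i 1)" "\<lambda>t. g (x + t *\<^sub>R axis i 1)"]
    obtain t where t: "0 < t" "t < h"
      "f (x + h *\<^sub>R axis i 1) - f (x + 0 *\<^sub>R axis i 1) = (h - 0) * g (x + t *\<^sub>R axis i 1)" by blast
    then have "diff_quot i h f x = g (x + t *\<^sub>R axis i 1)"
      using h by (simp add: diff_quot_def)
    then show ?thesis using r near t by simp
  qed
  moreover have "\<forall>\<^sub>F h in at_right 0. 0 < h \<and> h < r / 2"
    using \<open>r > 0\<close> by (auto simp: eventually_at_right_field intro!: exI[of _ "r / 2"])
  moreover have "\<forall>\<^sub>F x in nhds x0. dist x x0 < r / 2"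
    using \<open>r > 0\<close> by (auto simp: eventually_nhds_metric intro!: exI[of _ "r / 2"])
  ultimately show "\<forall>\<^sub>F hx in at_right 0 \<times>\<^sub>F nhds x0. dist (case hx of (h, x) \<Rightarrow> diff_quot i h f x) (g x0) < e"
    unfolding eventually_prod_filter
    by (intro exI[of _ "\<lambda>h. 0 < h \<and> h < r / 2"] exI[of _ "\<lambda>x. dist x x0 < r / 2"]) auto
qed

text \<open>Differentiation commutes with translation, so a difference quotient of \<open>u\<close>
  is as regular as \<open>u\<close> itself. This is why the regularized squared gradient can be
  differentiated twice.\<close>

lemma has_axis_deriv_diff_quot:
  assumes "has_axis_deriv f (f1 x) i x" "has_axis_deriv f (f1 (x + h *\<^sub>R axis j 1)) i (x + h *\<^sub>R axis j 1)"
  shows "has_axis_deriv (diff_quot j h f) (diff_quot j h f1 x) i x"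
proof -
  have "((\<lambda>t. (f (x + h *\<^sub>R axis j 1 + t *\<^sub>R axis i 1) - f (x + t *\<^sub>R axis i 1)) / h)
      has_real_derivative (f1 (x + h *\<^sub>R axis j 1) - f1 x) / h) (at 0)"
    using assms unfolding has_axis_deriv_def by (intro DERIV_cdivide DERIV_diff)
  then show ?thesis
    by (simp add: has_axis_deriv_def diff_quot_def algebra_simps)
qed

section \<open>First and second order conditions at a maximum\<close>

text \<open>If \<open>d\<close> were positive, \<open>f'\<close>, which vanishes at 0, would be
  positive just to the right of 0, and the mean value theorem would give a value above
  \<open>f 0\<close>. Thus \<open>f'\<close> has to be differentiable at 0 only.\<close>

lemma second_derivative_le_zero_at_max:
  fixes f :: "real \<Rightarrow> real"
  assumes "r > 0"
    and der: "\<And>t. \<bar>t\<bar> < r \<Longrightarrow> (f has_real_derivative f' t) (at t)"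
    and der2: "(f' has_real_derivative d) (at 0)"
    and max: "\<And>t. \<bar>t\<bar> < r \<Longrightarrow> f t \<le> f 0"
  shows "d \<le> 0"
proof (rule ccontr)
  assume "\<not> d \<le> 0"
  then obtain e where e: "e > 0" "\<And>h. 0 < h \<Longrightarrow> h < e \<Longrightarrow> f' 0 < f' (0 + h)"
    using DERIV_pos_inc_right[OF der2] by auto
  have zero: "f' 0 = 0"
    using DERIV_local_max[OF der[of 0] \<open>r > 0\<close>] max \<open>r > 0\<close> by simp
  define b where "b = min e r / 2"
  have b: "0 < b" "b < e" "b < r" using e \<open>r > 0\<close> by (auto simp: b_def min_def)
  obtain t where t: "0 < t" "t < b" "f b - f 0 = (b - 0) * f' t"
    using MVT2[OF b(1), of f f'] der b by (metis abs_of_nonneg le_less_trans)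
  have "f b - f 0 > 0" using t e(2)[of t] b zero by simp
  with max[of b] b show False by simp
qed

lemma axis_second_deriv_le_zero_at_max:
  fixes f :: "real ^ 'n::finite \<Rightarrow> real"
  assumes "open S" "x \<in> S"
    and der: "\<And>y. y \<in> S \<Longrightarrow> has_axis_deriv f (f1 y) i y"
    and der2: "has_axis_deriv f1 d i x"
    and max: "\<And>y. y \<in> S \<Longrightarrow> f y \<le> f x"
  shows "d \<le> 0"
proof -
  obtain r where r: "r > 0" "ball x r \<subseteq> S" using assms open_contains_ball by blast
  have near: "x + t *\<^sub>R axis i 1 \<in> S" if "\<bar>t\<bar> < r" for t
    using r that by (auto simp: subset_iff dist_norm)
  have line: "((\<lambda>t. f (x + t *\<^sub>R axis i 1)) has_real_derivative f1 (x + t *\<^sub>R axis i 1)) (at t)"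
    if "\<bar>t\<bar> < r" for t
    using has_axis_deriv_line[OF der[OF near[OF that]]] .
  show ?thesis
    by (rule second_derivative_le_zero_at_max[OF r(1) line])
      (use near der2 max in \<open>auto simp: has_axis_deriv_def\<close>)
qed

lemma axis_deriv_zero_at_max:
  fixes f :: "real ^ 'n::finite \<Rightarrow> real"
  assumes "open S" "x \<in> S" "has_axis_deriv f d i x"
    and max: "\<And>y. y \<in> S \<Longrightarrow> f y \<le> f x"
  shows "d = 0"
proof -
  obtain r where r: "r > 0" "ball x r \<subseteq> S" using assms open_contains_ball by blast
  have near: "x + t *\<^sub>R axis i 1 \<in> S" if "\<bar>t\<bar> < r" for t
    using r that by (auto simp: subset_iff dist_norm)
  show ?thesis
    using assms(3) unfolding has_axis_deriv_def
    by (rule DERIV_local_max[OF _ r(1)]) (use near max in auto)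
qed

section \<open>Calculus rules for axis derivatives\<close>

lemma has_axis_deriv_add:
  "has_axis_deriv f D i x \<Longrightarrow> has_axis_deriv g E i x \<Longrightarrow> has_axis_deriv (\<lambda>y. f y + g y) (D + E) i x"
  unfolding has_axis_deriv_def by (rule DERIV_add)

lemma has_axis_deriv_diff:
  "has_axis_deriv f D i x \<Longrightarrow> has_axis_deriv g E i x \<Longrightarrow> has_axis_deriv (\<lambda>y. f y - g y) (D - E) i x"
  unfolding has_axis_deriv_def by (rule DERIV_diff)

lemma has_axis_deriv_cmult:
  "has_axis_deriv f D i x \<Longrightarrow> has_axis_deriv (\<lambda>y. c * f y) (c * D) i x"
  unfolding has_axis_deriv_def by (rule DERIV_cmult)

lemma has_axis_deriv_mult:
  assumes "has_axis_deriv f D i x" "has_axis_deriv g E i x"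
  shows "has_axis_deriv (\<lambda>y. f y * g y) (D * g x + E * f x) i x"
  using DERIV_mult[OF assms[unfolded has_axis_deriv_def]] by (simp add: has_axis_deriv_def)

lemma has_axis_deriv_sum:
  "(\<And>k. k \<in> K \<Longrightarrow> has_axis_deriv (f k) (D k) i x) \<Longrightarrow>
    has_axis_deriv (\<lambda>y. \<Sum>k\<in>K. f k y) (\<Sum>k\<in>K. D k) i x"
  unfolding has_axis_deriv_def by (rule DERIV_sum)

lemma has_axis_deriv_power2:
  assumes "has_axis_deriv f D i x"
  shows "has_axis_deriv (\<lambda>y. (f y)\<^sup>2) (2 * (f x * D)) i x"
  using has_axis_deriv_mult[OF assms assms] by (simp add: power2_eq_square mult.commute)

lemma has_axis_deriv_compose:
  assumes "has_axis_deriv f D i x" "(g has_real_derivative E) (at (f x))"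
  shows "has_axis_deriv (\<lambda>y. g (f y)) (E * D) i x"
  using assms DERIV_chain2[of g E "\<lambda>t. f (x + t *\<^sub>R axis i 1)" 0 D UNIV]
  by (simp add: has_axis_deriv_def)

lemma has_axis_deriv_const: "has_axis_deriv (\<lambda>y. c) 0 i x"
  by (simp add: has_axis_deriv_def)

lemma has_axis_deriv_component:
  "has_axis_deriv (\<lambda>y. y $ j) (if i = j then 1 else 0) i x"
proof -
  have "axis i (1 :: real) $ j = (if i = j then 1 else 0)" by (simp add: axis_def)
  then show ?thesis
    unfolding has_axis_deriv_def by (auto intro!: derivative_eq_intros)
qed

lemma has_axis_deriv_component_diff:
  "has_axis_deriv (\<lambda>y. y $ j - a $ j) (if i = j then 1 else 0) i x"
  using has_axis_deriv_diff[OF has_axis_deriv_component[of j i x] has_axis_deriv_const[of "a $ j"]] by simp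

lemma norm_power2_vec: "(norm (x :: real ^ 'n))\<^sup>2 = (\<Sum>i\<in>UNIV. (x $ i)\<^sup>2)"
  by (simp add: norm_vec_def L2_set_def sum_nonneg)

lemma has_axis_deriv_dist_power2:
  "has_axis_deriv (\<lambda>y. (norm (y - a))\<^sup>2) (2 * (x $ i - a $ i)) i x"
proof -
  have "has_axis_deriv (\<lambda>y. \<Sum>j\<in>UNIV. (y $ j - a $ j)\<^sup>2)
      (\<Sum>j\<in>UNIV. 2 * ((x $ j - a $ j) * (if i = j then 1 else 0))) i x"
    by (intro has_axis_deriv_sum has_axis_deriv_power2 has_axis_deriv_component_diff)
  then
  show ?thesis by (simp add: norm_power2_vec if_distrib cong: if_cong)
qed

subsection \<open>Bochner's formula at a maximum point of a $C^2$ function\<close>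

lemma bernstein_at_max:
  fixes u \<phi> :: "real ^ 'n::finite \<Rightarrow> real"
  assumes S: "open S" "x0 \<in> S"
    and u1: "\<And>y i. y \<in> S \<Longrightarrow> has_axis_deriv u (u1 i y) i y"
    and u2: "\<And>y i j. y \<in> S \<Longrightarrow> has_axis_deriv (u1 i) (u2 i j y) j y"
    and cont_u: "continuous_on S u"
    and cont_u1: "\<And>i. continuous_on S (u1 i)"
    and cont_u2: "\<And>i j. continuous_on S (u2 i j)"
    and L: "\<And>y. y \<in> S \<Longrightarrow> (\<Sum>i\<in>UNIV. u2 i i y) = L y"
    and L1: "\<And>y j. y \<in> S \<Longrightarrow> has_axis_deriv L (L1 j y) j y"
    and cont_L1: "\<And>j. isCont (L1 j) x0"
    and \<phi>1: "\<And>y i. y \<in> S \<Longrightarrow> has_axis_deriv \<phi> (\<phi>1 i y) i y"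
    and \<phi>2: "\<And>y i. y \<in> S \<Longrightarrow> has_axis_deriv (\<phi>1 i) (\<phi>2 i y) i y"
    and cont_\<phi>: "continuous_on S \<phi>"
    and cont_\<phi>2: "\<And>i. continuous_on S (\<phi>2 i)"
    and max: "\<And>y. y \<in> S \<Longrightarrow> (\<Sum>j\<in>UNIV. (u1 j y)\<^sup>2) - \<phi> y \<le> (\<Sum>j\<in>UNIV. (u1 j x0)\<^sup>2) - \<phi> x0"
  shows "2 * (\<Sum>j\<in>UNIV. \<Sum>i\<in>UNIV. (u2 i j x0)\<^sup>2) + 2 * (\<Sum>j\<in>UNIV. u1 j x0 * L1 j x0) \<le> (\<Sum>i\<in>UNIV. \<phi>2 i x0)"
proof (rule ccontr)
  assume contra: "\<not> ?thesis"
  define G where "G = 2 * (\<Sum>j\<in>UNIV. \<Sum>i\<in>UNIV. (u2 i j x0)\<^sup>2) + 2 * (\<Sum>j\<in>UNIV. u1 j x0 * L1 j x0)"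
  define \<delta> where "\<delta> = G - (\<Sum>i\<in>UNIV. \<phi>2 i x0)"
  have "\<delta> > 0" using contra by (simp add: \<delta>_def G_def)
  \<comment> \<open>The penalty \<open>c * (norm (x - x0))\<^sup>2\<close> has Laplacian
    \<open>\<delta> / 2\<close>: it uses up half of the assumed gap \<open>\<delta>\<close>, and the
    other half absorbs the error of replacing derivatives by difference quotients.\<close>
  define c where "c = \<delta> / (4 * CARD('n))"
  have "c > 0" using \<open>\<delta> > 0\<close> by (simp add: c_def)
  have c_sum: "(\<Sum>i\<in>(UNIV :: 'n set). c * 2) = \<delta> / 2" by (simp add: c_def)
  define zh where "zh h x = (\<Sum>j\<in>UNIV. (diff_quot j h u x)\<^sup>2)" for h x
  define zh1 where "zh1 h i x = (\<Sum>j\<in>UNIV. 2 * (diff_quot j h u x * diff_quot j h (u1 i) x))" for h i x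
  define zh2 where "zh2 h i x = (\<Sum>j\<in>UNIV. 2 * (diff_quot j h (u1 i) x * diff_quot j h (u1 i) x
      + diff_quot j h (u2 i i) x * diff_quot j h u x))" for h i x
  define w where "w h x = zh h x - \<phi> x - c * (norm (x - x0))\<^sup>2" for h x
  \<comment> \<open>The discrete counterpart of the right-hand side of Bochner's formula; it turns
    out to be the Laplacian of \<open>zh h\<close>.\<close>
  let ?T = "\<lambda>h x. 2 * (\<Sum>j\<in>UNIV. \<Sum>i\<in>UNIV. (diff_quot j h (u1 i) x)\<^sup>2)
      + 2 * (\<Sum>j\<in>UNIV. diff_quot j h u x * diff_quot j h L x)"
  have isCont: "isCont f x" if "continuous_on S f" "x \<in> S" for f :: "real^'n \<Rightarrow> real" and x
    using that S continuous_on_eq_continuous_at by blast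
  have filter_fst: "((\<lambda>(h, x). f x) \<longlongrightarrow> f x) (at_right (0::real) \<times>\<^sub>F nhds x)" if "isCont f x"
    for f :: "real^'n \<Rightarrow> real" and x
  proof -
    have "(f \<longlongrightarrow> f x) (nhds x)" using that by (simp add: continuous_at tendsto_at_iff_tendsto_nhds)
    then show ?thesis
      unfolding case_prod_unfold by (rule filterlim_compose) (rule filterlim_snd)
  qed
  have u_lim: "((\<lambda>(h, x). diff_quot j h u x) \<longlongrightarrow> u1 j x) (at_right 0 \<times>\<^sub>F nhds x)" if "x \<in> S" for j x
    by (rule diff_quot_tendsto[OF S(1) that u1]) (use isCont cont_u1 that in auto)
  have u1_lim: "((\<lambda>(h, x). diff_quot j h (u1 i) x) \<longlongrightarrow> u2 i j x) (at_right 0 \<times>\<^sub>F nhds x)" if "x \<in> S" for i j x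
    by (rule diff_quot_tendsto[OF S(1) that u2]) (use isCont cont_u2 that in auto)
  have L_lim: "((\<lambda>(h, x). diff_quot j h L x) \<longlongrightarrow> L1 j x0) (at_right 0 \<times>\<^sub>F nhds x0)" for j
    by (rule diff_quot_tendsto[OF S L1]) (use cont_L1 in auto)
  have "((\<lambda>(h, x). ?T h x - (\<Sum>i\<in>UNIV. \<phi>2 i x)) \<longlongrightarrow> G - (\<Sum>i\<in>UNIV. \<phi>2 i x0)) (at_right 0 \<times>\<^sub>F nhds x0)"
    using u_lim[OF S(2)] u1_lim[OF S(2)] L_lim filter_fst[OF isCont[OF cont_\<phi>2 S(2)]]
    unfolding G_def case_prod_unfold
    by (intro tendsto_intros) 
  then have "\<forall>\<^sub>F (h, x) in at_right 0 \<times>\<^sub>F nhds x0. ?T h x - (\<Sum>i\<in>UNIV. \<phi>2 i x) > \<delta> / 2"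
    using order_tendstoD(1)[of _ \<delta> _ "\<delta> / 2"] \<open>\<delta> > 0\<close> unfolding \<delta>_def case_prod_unfold by fastforce
  then obtain P Q where P: "eventually P (at_right (0::real))" and Q: "eventually Q (nhds x0)"
    and PQ: "\<And>h x. P h \<Longrightarrow> Q x \<Longrightarrow> ?T h x - (\<Sum>i\<in>UNIV. \<phi>2 i x) > \<delta> / 2"
    unfolding eventually_prod_filter by auto
  obtain h0 where h0: "h0 > 0" "\<And>h. 0 < h \<Longrightarrow> h < h0 \<Longrightarrow> P h"
    using P unfolding eventually_at_right_field by auto
  have "eventually (\<lambda>x. Q x \<and> x \<in> S) (nhds x0)"
    using Q S by (simp add: eventually_conj_iff eventually_nhds_in_open)
  then obtain r where r: "r > 0" "\<And>x. dist x x0 < r \<Longrightarrow> Q x \<and> x \<in> S"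
    unfolding eventually_nhds_metric by auto
  define \<rho> where "\<rho> = r / 2"
  have \<rho>: "0 < \<rho>" "\<rho> < r" using r by (auto simp: \<rho>_def)
  define h1 where "h1 = min h0 (r / 2)"
  have "h1 > 0" using h0 r by (simp add: h1_def)
  have shift: "x + h *\<^sub>R axis j 1 \<in> S" if "0 < h" "h < h1" "dist x x0 \<le> \<rho>" for h x j
    using dist_axis_step[of x h j x0] r(2)[of "x + h *\<^sub>R axis j 1"] that by (simp add: h1_def \<rho>_def)
  have inS: "x \<in> S" if "dist x x0 \<le> \<rho>" for x using r(2) that \<rho> by simp
  \<comment> \<open>At an interior maximum of \<open>w h\<close> the Laplacian of
    \<open>zh h - \<phi>\<close> would be at most \<open>\<delta> / 2\<close>, whereas
    \<open>?T\<close> exceeds the Laplacian of \<open>\<phi>\<close> by more than that near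
    \<open>x0\<close>.\<close>
  have no_interior_max: False
    if h: "0 < h" "h < h1" and x: "dist x x0 < \<rho>" and mx: "\<And>y. dist y x0 \<le> \<rho> \<Longrightarrow> w h y \<le> w h x" for h x
  proof -
    let ?B = "ball x0 \<rho>"
    have sh: "y \<in> S" "y + h *\<^sub>R axis j 1 \<in> S" if "y \<in> ?B" for y j
      using that shift[OF h] inS by (auto simp: dist_commute)
    have "zh2 h i x - \<phi>2 i x - c * 2 \<le> 0" for i
    proof (rule axis_second_deriv_le_zero_at_max[of ?B x "w h" "\<lambda>y. zh1 h i y - \<phi>1 i y - c * (2 * (y $ i - x0 $ i))" i])
      show "has_axis_deriv (w h) (zh1 h i y - \<phi>1 i y - c * (2 * (y $ i - x0 $ i))) i y" if "y \<in> ?B" for y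
        unfolding w_def zh_def zh1_def
        by (intro has_axis_deriv_diff has_axis_deriv_sum has_axis_deriv_power2 has_axis_deriv_cmult
            has_axis_deriv_dist_power2 \<phi>1 has_axis_deriv_diff_quot u1 sh that)
      have "has_axis_deriv (\<lambda>y. y $ i - x0 $ i) 1 i x"
        using has_axis_deriv_component_diff[of i x0 i x] by simp
      then have "has_axis_deriv (\<lambda>y. 2 * (y $ i - x0 $ i)) 2 i x"
        by (rule has_axis_deriv_cmult[of _ 1 i x 2, unfolded mult_1_right])
      moreover have xB: "x \<in> ?B" using x by (simp add: dist_commute)
      ultimately show "has_axis_deriv (\<lambda>y. zh1 h i y - \<phi>1 i y - c * (2 * (y $ i - x0 $ i))) (zh2 h i x - \<phi>2 i x - c * 2) i x"
        unfolding zh1_def zh2_def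
        by (intro has_axis_deriv_diff has_axis_deriv_sum has_axis_deriv_mult has_axis_deriv_cmult \<phi>2
            has_axis_deriv_diff_quot u1 u2 sh[OF xB])
    qed (use x mx in \<open>auto simp: dist_commute\<close>)
    then have "(\<Sum>i\<in>UNIV. zh2 h i x - \<phi>2 i x - c * 2) \<le> 0" by (intro sum_nonpos) simp
    then have *: "(\<Sum>i\<in>UNIV. zh2 h i x) - (\<Sum>i\<in>UNIV. \<phi>2 i x) \<le> \<delta> / 2"
      using c_sum by (simp add: sum_subtractf)
    have "(\<Sum>i\<in>UNIV. zh2 h i x) = (\<Sum>j\<in>UNIV. \<Sum>i\<in>UNIV. 2 * (diff_quot j h (u1 i) x)\<^sup>2 + 2 * (diff_quot j h (u2 i i) x * diff_quot j h u x))"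
      unfolding zh2_def by (subst sum.swap) (simp add: power2_eq_square algebra_simps)
    also have "\<dots> = (\<Sum>j\<in>UNIV. 2 * (\<Sum>i\<in>UNIV. (diff_quot j h (u1 i) x)\<^sup>2) + 2 * (diff_quot j h u x * (\<Sum>i\<in>UNIV. diff_quot j h (u2 i i) x)))"
      by (simp add: sum.distrib sum_distrib_left mult.commute mult.left_commute)
    \<comment> \<open>The Laplacian commutes with difference quotients, so the second derivatives of
      \<open>u\<close> combine into the differentiable function \<open>L\<close>.\<close>
    also have "(\<lambda>j. \<Sum>i\<in>UNIV. diff_quot j h (u2 i i) x) = (\<lambda>j. diff_quot j h L x)"
      using L[OF inS] L[OF shift[OF h]] x
      by (simp add: diff_quot_def fun_eq_iff sum_subtractf flip: sum_divide_distrib)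
    finally have "(\<Sum>i\<in>UNIV. zh2 h i x) = ?T h x"
      by (simp add: sum.distrib sum_distrib_left)
    with PQ[of h x] * h0 r(2)[of x] h x \<rho> show False by (simp add: h1_def)
  qed
  \<comment> \<open>So each \<open>w h\<close> is maximal on the sphere; as \<open>h\<close> tends to 0, a limit point of the
    maximizers contradicts the maximality of \<open>x0\<close> because of the term \<open>c * (norm (x - x0))\<^sup>2\<close>.\<close>
  have "\<exists>x. dist x x0 = \<rho> \<and> w h x0 \<le> w h x" if h: "0 < h" "h < h1" for h
  proof -
    have "continuous_on (cball x0 \<rho>) (w h)"
    proof -
      have "continuous_on (cball x0 \<rho>) (\<lambda>x. u (x + h *\<^sub>R axis j 1))" for j
        by (rule continuous_on_compose2[OF cont_u]) (use shift[OF h] in \<open>auto intro!: continuous_intros simp: dist_commute\<close>)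
      moreover have "continuous_on (cball x0 \<rho>) u" "continuous_on (cball x0 \<rho>) \<phi>"
        using inS by (auto intro!: continuous_on_subset[OF cont_u] continuous_on_subset[OF cont_\<phi>] simp: dist_commute)
      ultimately show ?thesis
        unfolding w_def zh_def diff_quot_def by (intro continuous_intros) (use h in auto)
    qed
    then obtain x where x: "x \<in> cball x0 \<rho>" "\<And>y. y \<in> cball x0 \<rho> \<Longrightarrow> w h y \<le> w h x"
      using continuous_attains_sup[of "cball x0 \<rho>" "w h"] \<rho> by auto
    then have x_max: "w h y \<le> w h x" if "dist y x0 \<le> \<rho>" for y
      using that by (simp add: dist_commute)
    have "\<rho> \<le> dist x x0" using no_interior_max[OF h _ x_max] by (meson not_le)
    with x(1) have "dist x x0 = \<rho>" by (simp add: dist_commute)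
    moreover have "w h x0 \<le> w h x" using x(2) \<rho> by simp
    ultimately show ?thesis by blast
  qed
  moreover define hs where "hs n = h1 / (real n + 2)" for n
  have hs: "0 < hs n" "hs n < h1" for n
    using \<open>h1 > 0\<close> by (auto simp: hs_def field_simps add_strict_increasing)
  ultimately have "\<forall>n. \<exists>x. dist x x0 = \<rho> \<and> w (hs n) x0 \<le> w (hs n) x"
    by blast
  then obtain xs where "\<forall>n. dist (xs n) x0 = \<rho> \<and> w (hs n) x0 \<le> w (hs n) (xs n)"
    by (rule choice[THEN exE])
  then have xs: "dist (xs n) x0 = \<rho>" "w (hs n) x0 \<le> w (hs n) (xs n)" for n
    by auto
  have "compact (sphere x0 \<rho>)" by simp
  moreover have "\<forall>n. xs n \<in> sphere x0 \<rho>" using xs by (simp add: dist_commute)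
  ultimately obtain x s where x: "x \<in> sphere x0 \<rho>" "strict_mono s" "(xs \<circ> s) \<longlonglongrightarrow> x"
    unfolding compact_def by metis
  have "hs \<longlonglongrightarrow> 0" unfolding hs_def by real_asymp
  then have "(hs \<circ> s) \<longlonglongrightarrow> 0" using LIMSEQ_subseq_LIMSEQ x by blast
  then have hlim: "filterlim (\<lambda>n. hs (s n)) (at_right 0) sequentially"
    using hs(1) by (simp add: filterlim_at comp_def less_imp_neq[THEN not_sym])
  have xS: "x \<in> S" using x inS by (simp add: dist_commute)
  \<comment> \<open>Joint convergence in step and point lets this be applied both to the constant
    sequence \<open>x0\<close> and to the moving maximizers.\<close>
  have w_lim: "(\<lambda>n. w (hs (s n)) (y n)) \<longlonglongrightarrow> (\<Sum>j\<in>UNIV. (u1 j y')\<^sup>2) - \<phi> y' - c * (norm (y' - x0))\<^sup>2"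
    if "y \<longlonglongrightarrow> y'" "y' \<in> S" for y y'
  proof -
    have pair: "filterlim (\<lambda>n. (hs (s n), y n)) (at_right 0 \<times>\<^sub>F nhds y') sequentially"
      using hlim that by (intro filterlim_Pair) auto
    have 1: "(\<lambda>n. diff_quot j (hs (s n)) u (y n)) \<longlonglongrightarrow> u1 j y'" for j
      using filterlim_compose[OF u_lim[OF that(2)] pair] by simp
    have 2: "(\<lambda>n. \<phi> (y n)) \<longlonglongrightarrow> \<phi> y'"
      using isCont_tendsto_compose isCont[OF cont_\<phi> that(2)] that(1) by blast
    show ?thesis
      unfolding w_def zh_def using 1 2 that(1) by (intro tendsto_intros)
  qed
  have "(\<Sum>j\<in>UNIV. (u1 j x0)\<^sup>2) - \<phi> x0 - c * (norm (x0 - x0))\<^sup>2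
      \<le> (\<Sum>j\<in>UNIV. (u1 j x)\<^sup>2) - \<phi> x - c * (norm (x - x0))\<^sup>2"
    by (rule LIMSEQ_le[OF w_lim[OF tendsto_const S(2)] w_lim[OF x(3) xS]]) (use xs(2) in auto)
  with max[OF xS] have "c * (norm (x - x0))\<^sup>2 \<le> 0" by simp
  moreover have "norm (x - x0) = \<rho>" using x by (simp add: dist_norm norm_minus_commute)
  ultimately show False using \<open>c > 0\<close> \<rho> by (simp add: mult_le_0_iff)
qed

subsection \<open>The differential inequality for the squared gradient\<close>

lemma M_dagger_pos: "1 < p \<Longrightarrow> 0 < N \<Longrightarrow> 0 < M_dagger N p"
  by (simp add: M_dagger_def)

lemma M_dagger_young:
  assumes "p > 1" "u > 0" "z > 0" "N > 0"
  shows "real N * p * u powr (p - 1) * z \<le> (u powr p + M_dagger N p * z powr (p / (p + 1)))\<^sup>2"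
proof -
  \<comment> \<open>The weights make \<open>(u powr p) powr \<theta>\<close> and \<open>(z powr (p / (p + 1))) powr \<eta>\<close> the square roots of
    \<open>u powr (p - 1)\<close> and \<open>z\<close>.\<close>
  define \<theta> where "\<theta> = (p - 1) / (2 * p)"
  define \<eta> where "\<eta> = (p + 1) / (2 * p)"
  have \<theta>: "0 < \<theta>" "0 < \<eta>" "\<theta> + \<eta> = 1" using assms by (auto simp: \<theta>_def \<eta>_def field_simps)
  define Y where "Y = M_dagger N p * z powr (p / (p + 1))"
  have "Y > 0" using assms M_dagger_pos[of p N] by (simp add: Y_def)
  have e: "(p - 1) / (p + 1) * \<eta> = \<theta>" "p / (p + 1) * \<eta> = 1 / 2" "p * \<theta> = (p - 1) / 2"
    using assms by (simp_all add: \<theta>_def \<eta>_def divide_simps)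
  have "Y powr \<eta> = ((p - 1) / (p + 1)) powr \<theta> * (real N * (p + 1)\<^sup>2 / (4 * p)) powr (1/2) * z powr (1/2)"
    using assms unfolding Y_def M_dagger_def
    by (simp add: powr_mult powr_powr e del: times_divide_eq_left times_divide_eq_right)
  moreover have "(u powr p / \<theta>) powr \<theta> = u powr ((p - 1) / 2) / \<theta> powr \<theta>"
    using \<theta> by (simp add: powr_divide powr_powr e)
  moreover have "(Y / \<eta>) powr \<eta> = Y powr \<eta> / \<eta> powr \<eta>"
    using \<theta> \<open>Y > 0\<close> by (simp add: powr_divide)
  moreover have "(u powr p / \<theta>) powr \<theta> * (Y / \<eta>) powr \<eta> \<le> u powr p + Y"
    using Youngs_inequality_0[of \<theta> \<eta> "u powr p / \<theta>" "Y / \<eta>"] \<theta> \<open>Y > 0\<close> assms by simp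
  \<comment> \<open>The base is \<open>\<theta> / \<eta>\<close> and the weights add up to 1, so all
    powers of the weights collapse to \<open>1 / \<eta>\<close>.\<close>
  moreover have \<eta>_eq: "((p - 1) / (p + 1)) powr \<theta> / \<theta> powr \<theta> / \<eta> powr \<eta> = 1 / \<eta>"
  proof -
    have "((p - 1) / (p + 1)) powr \<theta> / \<theta> powr \<theta> = (1 / \<eta>) powr \<theta>"
      using assms \<theta> by (simp add: \<theta>_def \<eta>_def flip: powr_divide)
    also have "\<dots> = 1 / \<eta> powr \<theta>" using \<theta> by (simp add: powr_divide)
    finally show ?thesis using \<theta> by (simp flip: powr_add)
  qed
  ultimately have *: "1 / \<eta> * u powr ((p - 1) / 2) * (real N * (p + 1)\<^sup>2 / (4 * p)) powr (1/2) * z powr (1/2) \<le> u powr p + Y"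
    unfolding \<eta>_eq[symmetric] by (simp add: mult_ac)
  have "(1 / \<eta> * u powr ((p - 1) / 2) * B powr (1/2) * z powr (1/2))\<^sup>2
      = (1 / \<eta>)\<^sup>2 * u powr (p - 1) * B * z" if "B > 0" for B :: real
    using assms that by (simp add: power_mult_distrib power_divide powr_power diff_divide_distrib)
  then have "(1 / \<eta> * u powr ((p - 1) / 2) * (real N * (p + 1)\<^sup>2 / (4 * p)) powr (1/2) * z powr (1/2))\<^sup>2
      = (1 / \<eta>)\<^sup>2 * u powr (p - 1) * (real N * (p + 1)\<^sup>2 / (4 * p)) * z"
    using assms by simp
  also have "\<dots> = real N * p * u powr (p - 1) * z"
  proof -
    have "(2 * p / r)\<^sup>2 * (real N * r\<^sup>2 / (4 * p)) = real N * p" if "r > 0" for r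
      using assms that by (simp add: power2_eq_square)
    then have "(1 / \<eta>)\<^sup>2 * (real N * (p + 1)\<^sup>2 / (4 * p)) = real N * p"
      using assms by (simp add: \<eta>_def)
    then show ?thesis by (metis mult.assoc mult.commute)
  qed
  finally show ?thesis
    using power_mono[OF *, of 2] assms \<theta> by (simp add: Y_def)
qed

lemma norm_gradient_power2: "(norm (gradient u x))\<^sup>2 = (\<Sum>i\<in>UNIV. (partial_deriv i u x)\<^sup>2)"
  by (simp add: norm_power2_vec gradient_def)

lemma solution_at_max:
  fixes u \<phi> :: "real ^ 'n::finite \<Rightarrow> real"
  assumes p: "p > 1" "q = 2 * p / (p + 1)"
    and M: "M > M_dagger CARD('n) p"
    and sol: "classical_solution p q M \<Omega> u"
    and \<Omega>: "open \<Omega>" "\<And>x. x \<in> \<Omega> \<Longrightarrow> u x \<ge> 0"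
    and S: "open S" "S \<subseteq> \<Omega>" "x0 \<in> S"
    and nz: "gradient u x0 \<noteq> 0"
    and \<phi>1: "\<And>y i. y \<in> S \<Longrightarrow> has_axis_deriv \<phi> (\<phi>1 i y) i y"
    and \<phi>2: "\<And>y i. y \<in> S \<Longrightarrow> has_axis_deriv (\<phi>1 i) (\<phi>2 i y) i y"
    and cont_\<phi>: "continuous_on S \<phi>"
    and cont_\<phi>2: "\<And>i. continuous_on S (\<phi>2 i)"
    and max: "\<And>y. y \<in> S \<Longrightarrow> (norm (gradient u y))\<^sup>2 - \<phi> y \<le> (norm (gradient u x0))\<^sup>2 - \<phi> x0"
  shows "2 / CARD('n) * (M\<^sup>2 - (M_dagger CARD('n) p)\<^sup>2) * norm (gradient u x0) powr (2 * q)
      - q * M * norm (gradient u x0) powr (q - 1) * norm (\<chi> i. \<phi>1 i x0) \<le> (\<Sum>i\<in>UNIV. \<phi>2 i x0)"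
proof -
  define u1 where "u1 i = partial_deriv i u" for i
  define u2 where "u2 i j = partial_deriv j (partial_deriv i u)" for i j
  define z where "z y = (\<Sum>i\<in>UNIV. (u1 i y)\<^sup>2)" for y
  have z_eq: "z y = (norm (gradient u y))\<^sup>2" for y
    by (simp add: z_def u1_def norm_gradient_power2)
  have u1: "has_axis_deriv u (u1 i y) i y" if "y \<in> \<Omega>" for i y
    using sol that \<Omega> unfolding classical_solution_def C2_on_def u1_def
    by (auto intro!: has_axis_deriv_partial_deriv simp: differentiable_on_eq_differentiable_at)
  have u2: "has_axis_deriv (u1 i) (u2 i j y) j y" if "y \<in> \<Omega>" for i j y
    using sol that \<Omega> unfolding classical_solution_def C2_on_def u1_def u2_def
    by (auto intro!: has_axis_deriv_partial_deriv simp: differentiable_on_eq_differentiable_at)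
  have cont: "continuous_on \<Omega> u" "continuous_on \<Omega> (u1 i)" "continuous_on \<Omega> (u2 i j)" for i j
    using sol unfolding classical_solution_def C2_on_def u1_def u2_def
    by (auto intro: differentiable_imp_continuous_on)
  then have cont_z: "continuous_on \<Omega> z" unfolding z_def by (intro continuous_intros)
  have x0: "x0 \<in> \<Omega>" using S by auto
  have z0: "z x0 > 0" using nz by (simp add: z_eq)
  \<comment> \<open>A zero of \<open>u\<close> is a minimum point, so its gradient vanishes there; hence nonnegative
    solutions need no strong maximum principle.\<close>
  have u0: "u x0 > 0"
  proof (rule ccontr)
    assume "\<not> u x0 > 0"
    with \<Omega>(2)[OF x0] have "u x0 = 0" by simp
    have "- 1 * u1 i x0 = 0" for i
      by (rule axis_deriv_zero_at_max[OF \<Omega>(1) x0 has_axis_deriv_cmult[OF u1[OF x0]]])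
        (use \<Omega>(2) \<open>u x0 = 0\<close> in auto)
    then have "z x0 = 0" by (simp add: z_def)
    with z0 show False by simp
  qed
  \<comment> \<open>Where \<open>u\<close> and \<open>z\<close> are positive, the powers in the
    equation are differentiable, including \<open>z powr (q / 2)\<close> with exponent below 1, so
    the Laplacian of \<open>u\<close> has a continuous gradient.\<close>
  define V where "V = S \<inter> ((\<Omega> \<inter> u -` {0<..}) \<inter> (\<Omega> \<inter> z -` {0<..}))"
  have V_open: "open (\<Omega> \<inter> u -` {0<..})" "open (\<Omega> \<inter> z -` {0<..})"
    using \<Omega>(1) cont(1) cont_z by (auto intro: continuous_open_preimage)
  have V: "open V" "x0 \<in> V" "V \<subseteq> \<Omega>" "V \<subseteq> S" and V_pos: "\<And>y. y \<in> V \<Longrightarrow> u y > 0 \<and> z y > 0"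
    using S u0 z0 x0 open_Int[OF S(1) open_Int[OF V_open]] unfolding V_def by auto
  define L where "L y = - (u y powr p + M * z y powr (q / 2))" for y
  define L1 where "L1 j y = - (p * u y powr (p - 1) * u1 j y
      + M * (q / 2 * z y powr (q / 2 - 1) * (\<Sum>i\<in>UNIV. 2 * (u1 i y * u2 i j y))))" for j y
  have L: "(\<Sum>i\<in>UNIV. u2 i i y) = L y" if "y \<in> V" for y
  proof -
    have "- laplacian u y = \<bar>u y\<bar> powr (p - 1) * u y + M * norm (gradient u y) powr q"
      using sol that V by (auto simp: classical_solution_def)
    moreover have "\<bar>u y\<bar> powr (p - 1) * u y = u y powr p"
      using V_pos[OF that] by (simp add: powr_diff)
    moreover have "norm (gradient u y) powr q = z y powr (q / 2)"
      using V_pos[OF that] by (simp add: z_eq powr_powr flip: powr_numeral)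
    ultimately show ?thesis by (simp add: laplacian_def L_def u2_def)
  qed
  have z1: "has_axis_deriv z (\<Sum>i\<in>UNIV. 2 * (u1 i y * u2 i j y)) j y" if "y \<in> \<Omega>" for j y
    unfolding z_def by (intro has_axis_deriv_sum has_axis_deriv_power2 u2 that)
  have L1: "has_axis_deriv L (L1 j y) j y" if "y \<in> V" for j y
  proof -
    have y: "y \<in> \<Omega>" using that V by auto
    have "has_axis_deriv (\<lambda>y. - 1 * (u y powr p + M * z y powr (q / 2))) (- 1 * (p * u y powr (p - 1) * u1 j y
        + M * (q / 2 * z y powr (q / 2 - 1) * (\<Sum>i\<in>UNIV. 2 * (u1 i y * u2 i j y))))) j y"
      using V_pos[OF that]
      by (intro has_axis_deriv_cmult has_axis_deriv_add z1 u1 y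
          has_axis_deriv_compose[where g = "\<lambda>s. s powr _"] has_real_derivative_powr) auto
    then show ?thesis by (simp add: L_def[abs_def] L1_def)
  qed
  have cont_L1: "isCont (L1 j) x0" for j
  proof -
    have "isCont u x0" "isCont (u1 i) x0" "isCont (u2 i j) x0" "isCont z x0" for i j
      using cont cont_z \<Omega>(1) x0 continuous_on_eq_continuous_at by blast+
    then show ?thesis
      unfolding L1_def using u0 z0 by (intro continuous_intros) auto
  qed
  have cont_V: "continuous_on V u" "continuous_on V (u1 i)" "continuous_on V (u2 i j)"
      "continuous_on V \<phi>" "continuous_on V (\<phi>2 i)" for i j
    using continuous_on_subset[OF cont(1) V(3)] continuous_on_subset[OF cont(2) V(3)]
      continuous_on_subset[OF cont(3) V(3)] continuous_on_subset[OF cont_\<phi> V(4)]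
      continuous_on_subset[OF cont_\<phi>2 V(4)] by auto
  have bernstein: "2 * (\<Sum>j\<in>UNIV. \<Sum>i\<in>UNIV. (u2 i j x0)\<^sup>2) + 2 * (\<Sum>j\<in>UNIV. u1 j x0 * L1 j x0) \<le> (\<Sum>i\<in>UNIV. \<phi>2 i x0)"
    by (rule bernstein_at_max[OF V(1,2), of u u1 u2 L L1 \<phi> \<phi>1 \<phi>2])
      (use V u1 u2 L L1 cont_L1 \<phi>1 \<phi>2 max cont_V in
        \<open>auto simp flip: z_def simp: z_eq\<close>)
  \<comment> \<open>The first order condition at the maximum replaces the gradient of
    \<open>z\<close> inside \<open>L1\<close> by that of \<open>\<phi>\<close>.\<close>
  have z1_eq: "(\<Sum>i\<in>UNIV. 2 * (u1 i x0 * u2 i j x0)) = \<phi>1 j x0" for j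
  proof -
    have "(\<Sum>i\<in>UNIV. 2 * (u1 i x0 * u2 i j x0)) - \<phi>1 j x0 = 0"
      by (rule axis_deriv_zero_at_max[OF S(1,3) has_axis_deriv_diff[OF z1[OF x0] \<phi>1[OF S(3)]]])
        (use max in \<open>simp add: z_eq\<close>)
    then show ?thesis by simp
  qed
  let ?N = "real CARD('n)" and ?D = "M_dagger CARD('n) p"
  define g where "g = norm (gradient u x0)"
  define U where "U = u x0 powr p"
  define Z where "Z = g powr q"
  define F where "F = (\<Sum>j\<in>UNIV. u1 j x0 * \<phi>1 j x0)"
  have g: "g > 0" using nz by (simp add: g_def)
  have zg: "z x0 powr r = g powr (2 * r)" for r
    using powr_powr[of g 2 r] g by (simp add: z_eq g_def)
  have zZ: "z x0 powr (q / 2) = Z" by (simp add: zg Z_def)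
  have "M > 0" using M M_dagger_pos[of p "CARD('n)"] p by simp
  \<comment> \<open>Cauchy--Schwarz on the diagonal of the Hessian, then the off-diagonal squares
    are added.\<close>
  have "(L x0)\<^sup>2 \<le> ?N * (\<Sum>i\<in>UNIV. (u2 i i x0)\<^sup>2)"
    using sum_squared_le_sum_of_squares[of "\<lambda>i. u2 i i x0" UNIV] L[OF V(2)] by (simp add: mult.commute)
  also have "\<dots> \<le> ?N * (\<Sum>j\<in>UNIV. \<Sum>i\<in>UNIV. (u2 i j x0)\<^sup>2)"
    by (intro mult_left_mono sum_mono member_le_sum) auto
  finally have hess: "(U + M * Z)\<^sup>2 / ?N \<le> (\<Sum>j\<in>UNIV. \<Sum>i\<in>UNIV. (u2 i j x0)\<^sup>2)"
    by (simp add: L_def U_def zZ divide_simps mult.commute power2_commute)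
      (simp add: power2_eq_square algebra_simps)
  have young: "p * u x0 powr (p - 1) * z x0 \<le> (U + ?D * Z)\<^sup>2 / ?N"
  proof -
    have "q / 2 = p / (p + 1)" using p(1) by (simp add: p(2) field_simps)
    then have "z x0 powr (p / (p + 1)) = Z" using zZ by (simp only:)
    then show ?thesis
      using M_dagger_young[OF p(1) u0 z0, of "CARD('n)"] by (simp add: U_def pos_le_divide_eq mult_ac)
  qed
  have "(\<Sum>j\<in>UNIV. u1 j x0 * L1 j x0)
      = (\<Sum>j\<in>UNIV. - (p * u x0 powr (p - 1)) * (u1 j x0)\<^sup>2 - M * (q / 2 * z x0 powr (q / 2 - 1)) * (u1 j x0 * \<phi>1 j x0))"
    unfolding L1_def z1_eq by (intro sum.cong) (auto simp: algebra_simps power2_eq_square)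
  also have "\<dots> = - (p * u x0 powr (p - 1)) * z x0 - M * (q / 2 * z x0 powr (q / 2 - 1)) * F"
    by (simp only: sum_subtractf z_def F_def sum_distrib_left)
  finally have grad: "(\<Sum>j\<in>UNIV. u1 j x0 * L1 j x0)
      = - (p * u x0 powr (p - 1)) * z x0 - M * (q / 2 * z x0 powr (q / 2 - 1)) * F" .
  have "F = gradient u x0 \<bullet> (\<chi> i. \<phi>1 i x0)" by (simp add: F_def inner_vec_def gradient_def u1_def)
  then have "F \<le> g * norm (\<chi> i. \<phi>1 i x0)" unfolding g_def using norm_cauchy_schwarz by metis
  then have "M * (q / 2 * z x0 powr (q / 2 - 1)) * F \<le> M * (q / 2 * z x0 powr (q / 2 - 1)) * (g * norm (\<chi> i. \<phi>1 i x0))"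
    using \<open>M > 0\<close> p by (intro mult_left_mono) auto
  also have "\<dots> = M * q / 2 * (z x0 powr (q / 2 - 1) * g) * norm (\<chi> i. \<phi>1 i x0)" by simp
  also have "z x0 powr (q / 2 - 1) * g = g powr (q - 1)"
    using g powr_add[of g "q - 2" 1] by (simp add: zg algebra_simps)
  finally have drift: "M * (q / 2 * z x0 powr (q / 2 - 1)) * F \<le> M * q / 2 * g powr (q - 1) * norm (\<chi> i. \<phi>1 i x0)" .
  have "(U + ?D * Z)\<^sup>2 + (M\<^sup>2 - ?D\<^sup>2) * Z\<^sup>2 + 2 * (M - ?D) * U * Z = (U + M * Z)\<^sup>2"
    by (simp add: power2_eq_square algebra_simps)
  moreover have "2 * (M - ?D) * U * Z \<ge> 0" using M by (simp add: U_def Z_def)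
  ultimately have "((U + ?D * Z)\<^sup>2 + (M\<^sup>2 - ?D\<^sup>2) * Z\<^sup>2) / ?N \<le> (U + M * Z)\<^sup>2 / ?N"
    by (intro divide_right_mono) auto
  then have "(U + ?D * Z)\<^sup>2 / ?N + (M\<^sup>2 - ?D\<^sup>2) * Z\<^sup>2 / ?N \<le> (U + M * Z)\<^sup>2 / ?N"
    by (simp add: add_divide_distrib)
  moreover have "Z\<^sup>2 = g powr (2 * q)" using g by (simp add: Z_def powr_power)
  ultimately have "2 * ((M\<^sup>2 - ?D\<^sup>2) * g powr (2 * q) / ?N) - 2 * (M * q / 2 * g powr (q - 1) * norm (\<chi> i. \<phi>1 i x0)) \<le> (\<Sum>i\<in>UNIV. \<phi>2 i x0)"
    using bernstein hess young drift grad by (simp add: zZ)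
  moreover have "2 / n * c * x - q * M * y * v = 2 * (c * x / n) - 2 * (M * q / 2 * y * v)"
    for n c x y v :: real by simp
  ultimately show ?thesis by (simp only: g_def)
qed

text \<open>A crude bound free of square roots: beyond \<open>1 + c + b\<close> one has
  \<open>t > 1\<close>, so \<open>t\<^sup>2\<close> exceeds \<open>(1 + c + b) * t\<close> and hence
  \<open>c + b * t\<close>.\<close>

lemma quadratic_bound:
  fixes t b c :: real
  assumes "t\<^sup>2 \<le> c + b * t" "b \<ge> 0" "c \<ge> 0"
  shows "t \<le> 1 + c + b"
proof (rule ccontr)
  assume "\<not> ?thesis"
  then have t: "t > 1 + c + b" by simp
  then have "(1 + c + b) * t < t * t" using assms by (intro mult_strict_right_mono) auto
  moreover have "c * 1 \<le> c * t" using t assms by (intro mult_left_mono) auto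
  ultimately have "c + b * t < t * t" using t assms by (simp add: algebra_simps)
  then show False using assms by (simp add: power2_eq_square)
qed

subsection \<open>Interior gradient bound\<close>

lemma has_axis_deriv_barrier:
  fixes a :: "real ^ 'n::finite"
  assumes "norm (x - a) < R"
  shows "has_axis_deriv (\<lambda>y. (R\<^sup>2 - (norm (y - a))\<^sup>2) powr r)
    (- 2 * r * (x $ i - a $ i) * (R\<^sup>2 - (norm (x - a))\<^sup>2) powr (r - 1)) i x"
proof -
  have pos: "R\<^sup>2 - (norm (x - a))\<^sup>2 > 0" using assms by (simp add: power_strict_mono)
  have "has_axis_deriv (\<lambda>y. (R\<^sup>2 - (norm (y - a))\<^sup>2) powr r)
      (r * (R\<^sup>2 - (norm (x - a))\<^sup>2) powr (r - 1) * (0 - 2 * (x $ i - a $ i))) i x"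
    by (intro has_axis_deriv_compose[where g = "\<lambda>s. s powr r"] has_axis_deriv_diff
        has_axis_deriv_const has_axis_deriv_dist_power2 has_real_derivative_powr pos)
  moreover have "r * s * (0 - 2 * d) = - 2 * r * d * s" for s d :: real by simp
  ultimately show ?thesis by (simp only:)
qed

text \<open>The parameter \<open>K\<close> bounds the ratio of the squared drift coefficient to the
  coercivity \<open>A\<close>. Keeping it separate leaves \<open>A\<close> as the only other trace
  of \<open>M\<close> in the bound, so that a choice of \<open>K\<close> independent of
  \<open>M\<close> gives a uniform constant.\<close>

lemma gradient_bound_ball:
  fixes u :: "real ^ 'n::finite \<Rightarrow> real" and k :: real
  assumes p: "p > 1" "q = 2 * p / (p + 1)"
    and M: "M > M_dagger CARD('n) p"
    and sol: "classical_solution p q M \<Omega> u"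
    and \<Omega>: "open \<Omega>" "\<And>x. x \<in> \<Omega> \<Longrightarrow> u x \<ge> 0"
    and R: "R > 0" "cball a R \<subseteq> \<Omega>"
    and A: "A = 2 / CARD('n) * (M\<^sup>2 - (M_dagger CARD('n) p)\<^sup>2)"
    and K: "(q * M)\<^sup>2 \<le> K * A" "K \<ge> 0"
    and k: "k = 2 * ((p + 1) / (p - 1))"
  shows "norm (gradient u a) \<le>
    ((1 + (2 * k * CARD('n) + 4 * k * (k + 1)) + 2 * k * sqrt K) / (sqrt A * R)) powr ((p + 1) / (p - 1))"
proof (cases "gradient u a = 0")
  case False
  have Mpos: "M > 0" "M_dagger CARD('n) p > 0" using M M_dagger_pos[of p "CARD('n)"] p by auto
  then have "A > 0" using M unfolding A by (simp add: power_strict_mono)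
  have q: "q > 1" "q - 1 = (p - 1) / (p + 1)" using p(1) by (auto simp: p(2) field_simps)
  have k0: "k > 0" using p k by simp
  have kq: "k * ((q - 1) / 2) = 1" using p(1) by (simp add: k q)
  define \<psi> where "\<psi> y = R\<^sup>2 - (norm (y - a))\<^sup>2" for y
  define Z where "Z y = (norm (gradient u y))\<^sup>2 * \<psi> y powr k" for y
  have \<psi>_nonneg: "\<psi> y \<ge> 0" if "y \<in> cball a R" for y
    using that by (simp add: \<psi>_def dist_norm norm_minus_commute power_mono)
  have \<psi>_pos: "\<psi> y > 0" if "y \<in> ball a R" for y
    using that by (simp add: \<psi>_def dist_norm norm_minus_commute power_strict_mono)
  have "continuous_on \<Omega> (partial_deriv i u)" for i
    using sol by (auto simp: classical_solution_def C2_on_def intro: differentiable_imp_continuous_on)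
  then have cont_pd: "continuous_on (cball a R) (partial_deriv i u)" for i
    using R continuous_on_subset by blast
  have "continuous_on (cball a R) Z"
    unfolding Z_def norm_gradient_power2
  proof (intro continuous_on_mult continuous_on_sum continuous_on_power cont_pd continuous_on_powr')
    show "continuous_on (cball a R) \<psi>" unfolding \<psi>_def by (intro continuous_intros)
  qed (use \<psi>_nonneg k0 in auto)
  then obtain x0 where x0: "x0 \<in> cball a R" "\<And>y. y \<in> cball a R \<Longrightarrow> Z y \<le> Z x0"
    using continuous_attains_sup[of "cball a R" Z] R by auto
  have "Z a > 0" using False R by (simp add: Z_def \<psi>_def)
  define m where "m = Z x0"
  have m: "m > 0" "Z a \<le> m" using x0(2)[of a] R \<open>Z a > 0\<close> by (auto simp: m_def)
  \<comment> \<open>A positive maximum rules out the bounding sphere, where \<open>\<psi>\<close> is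
    0 and \<open>0 powr k = 0\<close>.\<close>
  then have nz: "gradient u x0 \<noteq> 0" and "\<psi> x0 \<noteq> 0" by (auto simp: m_def Z_def)
  then have x0_ball: "x0 \<in> ball a R"
    using x0(1) by (auto simp: \<psi>_def dist_norm norm_minus_commute less_le)
  define P where "P = \<psi> x0"
  have P: "P > 0" "P \<le> R\<^sup>2" using \<psi>_pos[OF x0_ball] by (auto simp: P_def \<psi>_def)
  \<comment> \<open>Maximality of \<open>Z\<close> at \<open>x0\<close> says that this barrier lies
    above the squared gradient in the ball and equals it at \<open>x0\<close>.\<close>
  define \<phi> where "\<phi> y = m * \<psi> y powr (- k)" for y
  define \<phi>1 where "\<phi>1 i y = m * (- 2 * (- k) * (y $ i - a $ i) * \<psi> y powr (- k - 1))" for i y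
  define \<phi>2 where "\<phi>2 i y = 2 * k * m * (\<psi> y powr (- k - 1)
      + (- 2 * (- k - 1) * (y $ i - a $ i) * \<psi> y powr (- k - 1 - 1)) * (y $ i - a $ i))" for i y
  define g where "g = norm (gradient u x0)"
  have cont_\<psi>: "continuous_on (ball a R) (\<lambda>y. \<psi> y powr s)" for s
  proof (rule continuous_on_powr)
    show "continuous_on (ball a R) \<psi>" unfolding \<psi>_def by (intro continuous_intros)
  qed (use \<psi>_pos in force)+
  have "2 / CARD('n) * (M\<^sup>2 - (M_dagger CARD('n) p)\<^sup>2) * norm (gradient u x0) powr (2 * q)
      - q * M * norm (gradient u x0) powr (q - 1) * norm (\<chi> i. \<phi>1 i x0) \<le> (\<Sum>i\<in>UNIV. \<phi>2 i x0)"
  proof (rule solution_at_max[OF p M sol \<Omega> open_ball _ x0_ball nz])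
    show "ball a R \<subseteq> \<Omega>" using R by auto
    show "has_axis_deriv \<phi> (\<phi>1 i y) i y" if "y \<in> ball a R" for y i
      unfolding \<phi>_def \<phi>1_def \<psi>_def
      by (intro has_axis_deriv_cmult has_axis_deriv_barrier)
        (use that in \<open>simp add: dist_norm norm_minus_commute\<close>)
    show "has_axis_deriv (\<phi>1 i) (\<phi>2 i y) i y" if "y \<in> ball a R" for y i
    proof -
      have "has_axis_deriv (\<lambda>y. y $ i - a $ i) 1 i y"
        using has_axis_deriv_component_diff[of i a i y] by simp
      moreover have "has_axis_deriv (\<lambda>y. \<psi> y powr (- k - 1)) (- 2 * (- k - 1) * (y $ i - a $ i) * \<psi> y powr (- k - 1 - 1)) i y"
        unfolding \<psi>_def by (rule has_axis_deriv_barrier) (use that in \<open>simp add: dist_norm norm_minus_commute\<close>)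
      ultimately have "has_axis_deriv (\<lambda>y. (2 * k * m) * ((y $ i - a $ i) * \<psi> y powr (- k - 1))) ((2 * k * m) * (1 * \<psi> y powr (- k - 1)
          + (- 2 * (- k - 1) * (y $ i - a $ i) * \<psi> y powr (- k - 1 - 1)) * (y $ i - a $ i))) i y"
        by (intro has_axis_deriv_cmult has_axis_deriv_mult)
      moreover have "\<phi>1 i = (\<lambda>y. (2 * k * m) * ((y $ i - a $ i) * \<psi> y powr (- k - 1)))"
        by (auto simp: \<phi>1_def fun_eq_iff)
      ultimately show ?thesis by (simp add: \<phi>2_def)
    qed
    show "continuous_on (ball a R) \<phi>"
      unfolding \<phi>_def by (intro continuous_intros cont_\<psi>)
    show "continuous_on (ball a R) (\<phi>2 i)" for i
      unfolding \<phi>2_def by (intro continuous_intros cont_\<psi>)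
    have z_eq: "(norm (gradient u y))\<^sup>2 = Z y * \<psi> y powr (- k)" if "y \<in> ball a R" for y
      using \<psi>_pos[OF that] by (simp add: Z_def powr_minus)
    show "(norm (gradient u y))\<^sup>2 - \<phi> y \<le> (norm (gradient u x0))\<^sup>2 - \<phi> x0" if "y \<in> ball a R" for y
      unfolding z_eq[OF that] z_eq[OF x0_ball] \<phi>_def m_def
      using x0(2)[of y] that by (simp add: mult_right_mono)
  qed
  then have ineq: "A * g powr (2 * q) - q * M * g powr (q - 1) * norm (\<chi> i. \<phi>1 i x0) \<le> (\<Sum>i\<in>UNIV. \<phi>2 i x0)"
    by (simp add: g_def A)
  have g: "g > 0" using nz by (simp add: g_def)
  define y where "y = m powr ((q - 1) / 2)"
  define W where "W = m * P powr (- k) / P\<^sup>2"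
  have W: "W > 0" and y: "y > 0" using m P by (auto simp: W_def y_def)
  have g2: "g\<^sup>2 = m * P powr (- k)" using P by (simp add: m_def Z_def g_def P_def powr_minus)
  have gq: "g powr (q - 1) = y / P"
  proof -
    have "g powr (q - 1) = (g\<^sup>2) powr ((q - 1) / 2)"
      using powr_powr[of g 2 "(q - 1) / 2"] g by (simp add: diff_divide_distrib)
    also have "\<dots> = y * P powr (- (k * ((q - 1) / 2)))"
      unfolding g2 y_def using m P by (simp add: powr_mult powr_powr)
    finally show ?thesis using P unfolding kq by (simp add: powr_minus divide_inverse)
  qed
  have gqq: "g powr (2 * q) = y\<^sup>2 * W"
  proof -
    have "g powr (2 * q) = g powr ((q - 1) + (q - 1) + 2)" by (simp add: algebra_simps)
    also have "\<dots> = (g powr (q - 1))\<^sup>2 * g\<^sup>2"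
      using g by (simp only: powr_add) (simp add: power2_eq_square)
    finally show ?thesis unfolding gq g2 by (simp add: W_def power_divide)
  qed
  have powr_minus_one: "P powr (s - 1) = P powr s / P" for s using P by (simp add: powr_diff)
  have P1: "P powr (- k - 1) = P powr (- k) / P" and P2: "P powr (- k - 1 - 1) = P powr (- k) / P\<^sup>2"
    by (simp_all only: powr_minus_one power2_eq_square divide_divide_eq_left)
  have dist_x0: "norm (x0 - a) \<le> R" using x0(1) by (simp add: dist_norm norm_minus_commute)
  have "(\<chi> i. \<phi>1 i x0) = (2 * k * m * P powr (- k) / P) *\<^sub>R (x0 - a)"
    using P1 by (simp add: vec_eq_iff \<phi>1_def flip: P_def)
  then have "norm (\<chi> i. \<phi>1 i x0) = (2 * k * m * P powr (- k) / P) * norm (x0 - a)"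
    using k0 m P by simp
  also have "\<dots> \<le> (2 * k * m * P powr (- k) / P) * R"
    using k0 m P dist_x0 by (intro mult_left_mono) auto
  finally have "q * M * g powr (q - 1) * norm (\<chi> i. \<phi>1 i x0) \<le> q * M * (y / P) * ((2 * k * m * P powr (- k) / P) * R)"
    unfolding gq using q Mpos y P by (intro mult_left_mono) auto
  also have "\<dots> = 2 * k * (q * M) * R * y * W" by (simp add: W_def power2_eq_square)
  finally have drift: "q * M * g powr (q - 1) * norm (\<chi> i. \<phi>1 i x0) \<le> 2 * k * (q * M) * R * y * W" .
  have "(\<Sum>i\<in>UNIV. \<phi>2 i x0) = (\<Sum>i\<in>(UNIV :: 'n set). 2 * k * P * W + 4 * k * (k + 1) * W * ((x0 - a) $ i)\<^sup>2)"
    unfolding \<phi>2_def P_def[symmetric] P1 P2 W_def using P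
    by (intro sum.cong) (auto simp: power2_eq_square field_simps)
  also have "\<dots> = CARD('n) * (2 * k * P * W) + 4 * k * (k + 1) * W * (norm (x0 - a))\<^sup>2"
    by (simp add: sum.distrib norm_power2_vec sum_distrib_left)
  also have "\<dots> \<le> CARD('n) * (2 * k * R\<^sup>2 * W) + 4 * k * (k + 1) * W * R\<^sup>2"
    using P k0 W dist_x0 by (intro add_mono mult_left_mono mult_right_mono power_mono) auto
  finally have lap: "(\<Sum>i\<in>UNIV. \<phi>2 i x0) \<le> (2 * k * CARD('n) + 4 * k * (k + 1)) * R\<^sup>2 * W"
    by (simp add: algebra_simps)
  define C where "C = 2 * k * CARD('n) + 4 * k * (k + 1)"
  have "C \<ge> 0" using k0 by (simp add: C_def)
  have "(A * y\<^sup>2) * W \<le> (C * R\<^sup>2 + 2 * k * (q * M) * R * y) * W"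
    using ineq drift lap unfolding gqq C_def by (simp add: algebra_simps)
  then have quad: "A * y\<^sup>2 \<le> C * R\<^sup>2 + 2 * k * (q * M) * R * y" using W by simp
  have qM: "q * M \<le> sqrt K * sqrt A"
    using real_le_rsqrt[OF K(1)] by (simp add: real_sqrt_mult)
  \<comment> \<open>In this scale the coefficients of the quadratic inequality involve neither
    \<open>R\<close> nor \<open>A\<close>.\<close>
  define t where "t = sqrt A * y / R"
  have "t\<^sup>2 = A * y\<^sup>2 / R\<^sup>2" using \<open>A > 0\<close> by (simp add: t_def power_divide power_mult_distrib)
  also have "\<dots> \<le> (C * R\<^sup>2 + 2 * k * (q * M) * R * y) / R\<^sup>2" using quad by (intro divide_right_mono) auto
  also have "\<dots> = C + 2 * k * (y / R) * (q * M)" using R by (simp add: field_simps power2_eq_square)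
  also have "\<dots> \<le> C + 2 * k * (y / R) * (sqrt K * sqrt A)"
    using k0 y R qM by (intro add_left_mono mult_left_mono) auto
  also have "\<dots> = C + (2 * k * sqrt K) * t" by (simp add: t_def)
  finally have "t \<le> 1 + C + 2 * k * sqrt K"
    using k0 K \<open>C \<ge> 0\<close> by (intro quadratic_bound) auto
  then have y_le: "y / R\<^sup>2 \<le> (1 + C + 2 * k * sqrt K) / (sqrt A * R)"
    using R \<open>A > 0\<close> by (simp add: t_def field_simps power2_eq_square)
  define ga where "ga = norm (gradient u a)"
  have ga: "ga > 0" using False by (simp add: ga_def)
  \<comment> \<open>At the centre \<open>\<psi> a\<close> is \<open>R\<^sup>2\<close>, so comparing
    \<open>Z a\<close> with the maximum \<open>m\<close> carries the bound on \<open>y\<close> over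
    to the gradient at \<open>a\<close>.\<close>
  have "ga powr (q - 1) * R\<^sup>2 = (Z a) powr ((q - 1) / 2)"
  proof -
    have "(Z a) powr ((q - 1) / 2) = (ga\<^sup>2) powr ((q - 1) / 2) * (R\<^sup>2) powr (k * ((q - 1) / 2))"
      using R ga by (simp add: Z_def \<psi>_def ga_def powr_mult powr_powr)
    also have "(ga\<^sup>2) powr ((q - 1) / 2) = ga powr (q - 1)"
      using powr_powr[of ga 2 "(q - 1) / 2"] ga by (simp add: diff_divide_distrib)
    finally show ?thesis using R unfolding kq by simp
  qed
  also have "\<dots> \<le> y" unfolding y_def using \<open>Z a > 0\<close> m q(1) by (intro powr_mono2) auto
  finally have "ga powr (q - 1) \<le> y / R\<^sup>2" using R by (simp add: field_simps)
  then have "ga powr (q - 1) \<le> (1 + C + 2 * k * sqrt K) / (sqrt A * R)" using y_le by simp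
  then have ga_le: "(ga powr (q - 1)) powr ((p + 1) / (p - 1)) \<le> ((1 + C + 2 * k * sqrt K) / (sqrt A * R)) powr ((p + 1) / (p - 1))"
    using p by (intro powr_mono2) auto
  have inv: "(q - 1) * ((p + 1) / (p - 1)) = 1" using p(1) by (simp add: q)
  have "(ga powr (q - 1)) powr ((p + 1) / (p - 1)) = ga"
    unfolding powr_powr inv using ga by simp
  with ga_le show ?thesis by (simp only: ga_def C_def)
qed simp

section \<open>Distance to the boundary and the uniform constant\<close>

text \<open>A connected ball meeting both \<open>S\<close> and its complement would meet the
  frontier, but its points are too close to \<open>a\<close> for that. For an empty frontier
  \<open>infdist\<close> is 0 and the ball is empty.\<close>

lemma ball_infdist_frontier_subset:
  fixes a :: "'a::real_normed_vector"
  assumes "a \<in> S"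
  shows "ball a (infdist a (frontier S)) \<subseteq> S"
proof (rule ccontr)
  let ?B = "ball a (infdist a (frontier S))"
  assume "\<not> ?B \<subseteq> S"
  then have "?B - S \<noteq> {}" "a \<in> ?B" by (auto simp: infdist_nonneg order.strict_iff_order)
  then have "?B \<inter> frontier S \<noteq> {}"
    using connected_Int_frontier[of ?B S] assms by blast
  then obtain b where "b \<in> frontier S" "dist a b < infdist a (frontier S)" by auto
  with infdist_le[of b "frontier S" a] show False by simp
qed

text \<open>The first bound makes \<open>A\<close> at least a multiple of \<open>M\<^sup>2\<close>,
  so the ratio \<open>K\<close> becomes independent of \<open>M\<close>; the second then expresses
  the estimate through \<open>(1 - \<nu>) * M - D\<close>.\<close>

lemma M_gap_lower_bound:
  fixes M D \<nu> :: real
  assumes "D > 0" "M > D" "\<nu> > 0" "(1 - \<nu>) * M > D"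
  shows "\<nu> * M\<^sup>2 \<le> M\<^sup>2 - D\<^sup>2" and "((1 - \<nu>) * M - D)\<^sup>2 \<le> M\<^sup>2"
proof -
  have "0 < (1 - \<nu>) * M" using assms by simp
  then have \<nu>: "\<nu> < 1" using assms by (simp add: zero_less_mult_iff)
  have *: "(1 - \<nu>) * M \<le> M" using assms by simp
  have "D\<^sup>2 = D * D" by (simp add: power2_eq_square)
  also have "\<dots> \<le> (1 - \<nu>) * M * M" using assms by (intro mult_mono) auto
  also have "\<dots> = M\<^sup>2 - \<nu> * M\<^sup>2" by (simp add: power2_eq_square algebra_simps)
  finally show "\<nu> * M\<^sup>2 \<le> M\<^sup>2 - D\<^sup>2" by simp
  show "((1 - \<nu>) * M - D)\<^sup>2 \<le> M\<^sup>2" using assms * by (intro power_mono) auto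
qed

lemma laplacian_zero_of_gradient_zero:
  assumes "\<And>x. gradient u x = 0"
  shows "laplacian u x = 0"
proof -
  have "partial_deriv i u = (\<lambda>_. 0)" for i
    using assms by (simp add: gradient_def vec_eq_iff fun_eq_iff)
  then show ?thesis by (simp add: laplacian_def) (simp add: partial_deriv_def)
qed

lemma gradient_estimate:
  fixes p q \<nu> :: real
  assumes p: "p > 1" "q = 2 * p / (p + 1)" and \<nu>: "\<nu> > 0"
  shows "\<exists>c>0. \<forall>M (\<Omega> :: (real ^ 'n::finite) set) u.
            M > M_dagger CARD('n) p \<longrightarrow> (1 - \<nu>) * M > M_dagger CARD('n) p \<longrightarrow>
            open \<Omega> \<longrightarrow> connected \<Omega> \<longrightarrow> frontier \<Omega> \<noteq> {} \<longrightarrow>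
            classical_solution p q M \<Omega> u \<longrightarrow> (\<forall>x\<in>\<Omega>. u x > 0) \<longrightarrow>
            (\<forall>x\<in>\<Omega>. norm (gradient u x) \<le>
               c * ((1 - \<nu>) * M - M_dagger CARD('n) p) powr (- ((p + 1) / (p - 1)))
                 * infdist x (frontier \<Omega>) powr (- ((p + 1) / (p - 1))))"
proof -
  define \<alpha> where "\<alpha> = (p + 1) / (p - 1)"
  define k where "k = 2 * \<alpha>"
  define N where "N = real CARD('n)"
  \<comment> \<open>The value of \<open>(q * M)\<^sup>2 / A\<close> when \<open>A\<close> is
    replaced by its lower bound \<open>2 / N * (\<nu> * M\<^sup>2)\<close>.\<close>
  define K where "K = q\<^sup>2 * N / (2 * \<nu>)"
  define C where "C = 1 + (2 * k * N + 4 * k * (k + 1)) + 2 * k * sqrt K"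
  define s where "s = sqrt (2 * \<nu> / N)"
  \<comment> \<open>The 2 comes from working in a ball of half the distance to the boundary, whose
    closure lies in the domain; \<open>s\<close> is the factor in
    \<open>s * X \<le> sqrt A\<close>.\<close>
  define c where "c = (2 * C / s) powr \<alpha>"
  have N: "N > 0" by (simp add: N_def)
  have \<alpha>: "\<alpha> > 0" and k: "k > 0" using p by (simp_all add: \<alpha>_def k_def)
  have K: "K \<ge> 0" using N \<nu> by (simp add: K_def)
  have C: "C > 0" using k N K unfolding C_def by (intro add_pos_nonneg) auto
  have s: "s > 0" using N \<nu> by (simp add: s_def)
  have c: "c > 0" using C s by (simp add: c_def)
  have "norm (gradient u a) \<le> c * ((1 - \<nu>) * M - M_dagger CARD('n) p) powr (- \<alpha>) * infdist a (frontier \<Omega>) powr (- \<alpha>)"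
    if M: "M > M_dagger CARD('n) p" "(1 - \<nu>) * M > M_dagger CARD('n) p"
      and \<Omega>: "open \<Omega>" "frontier \<Omega> \<noteq> {}"
      and sol: "classical_solution p q M \<Omega> u" and pos: "\<And>x. x \<in> \<Omega> \<Longrightarrow> u x > 0" and a: "a \<in> \<Omega>"
    for M \<Omega> and u :: "real ^ 'n \<Rightarrow> real" and a
  proof -
    define D where "D = M_dagger CARD('n) p"
    define X where "X = (1 - \<nu>) * M - D"
    define d where "d = infdist a (frontier \<Omega>)"
    define A where "A = 2 / N * (M\<^sup>2 - D\<^sup>2)"
    have X: "X > 0" using M by (simp add: X_def D_def)
    have D: "D > 0" using M_dagger_pos[of p "CARD('n)"] p by (simp add: D_def)
    have gap: "\<nu> * M\<^sup>2 \<le> M\<^sup>2 - D\<^sup>2" "X\<^sup>2 \<le> M\<^sup>2"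
      using M_gap_lower_bound[OF D _ \<nu>, of M] M by (auto simp: D_def X_def)
    have A_ge: "2 / N * (\<nu> * M\<^sup>2) \<le> A"
      unfolding A_def using N gap by (intro mult_left_mono) auto
    have "a \<notin> frontier \<Omega>" using a \<Omega> by (simp add: frontier_def interior_open)
    then have d: "d > 0"
      unfolding d_def using \<Omega>(2) by (simp add: infdist_pos_not_in_closed)
    have sub: "cball a (d / 2) \<subseteq> \<Omega>"
      using ball_infdist_frontier_subset[OF a] d by (force simp: d_def subset_iff)
    have "(q * M)\<^sup>2 = K * (2 / N * (\<nu> * M\<^sup>2))"
      using N \<nu> by (simp add: K_def power_mult_distrib)
    also have "\<dots> \<le> K * A" using A_ge K by (intro mult_left_mono) auto
    finally have KA: "(q * M)\<^sup>2 \<le> K * A" .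
    have "norm (gradient u a) \<le> (C / (sqrt A * (d / 2))) powr \<alpha>"
      using gradient_bound_ball[OF p M(1) sol \<Omega>(1) less_imp_le[OF pos] _ sub A_def[unfolded D_def N_def] KA K k_def[unfolded \<alpha>_def]] d
      by (simp add: C_def N_def \<alpha>_def)
    also have "\<dots> \<le> (C / (s * X * (d / 2))) powr \<alpha>"
    proof -
      have "s * X = sqrt (2 / N * (\<nu> * X\<^sup>2))" using X by (simp add: s_def real_sqrt_mult real_sqrt_divide)
      also have "\<dots> \<le> sqrt (2 / N * (\<nu> * M\<^sup>2))"
        using N \<nu> gap by (intro real_sqrt_le_mono mult_left_mono) auto
      also have "\<dots> \<le> sqrt A" using A_ge by simp
      finally have "s * X \<le> sqrt A" .
      moreover have "s * X > 0" using s X by simp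
      ultimately have "C / (sqrt A * (d / 2)) \<le> C / (s * X * (d / 2))" "sqrt A > 0"
        using d C by (auto intro!: frac_le mult_right_mono simp del: real_sqrt_gt_0_iff)
      then show ?thesis using d C \<alpha> by (intro powr_mono2) auto
    qed
    also have "C / (s * X * (d / 2)) = 2 * C / s * (1 / X) * (1 / d)" by simp
    also have "\<dots> powr \<alpha> = c * X powr (- \<alpha>) * d powr (- \<alpha>)"
      using C s X d by (simp add: c_def powr_mult powr_divide powr_minus_divide)
    finally show ?thesis by (simp add: X_def D_def d_def)
  qed
  then show ?thesis
    using c unfolding \<alpha>_def by (intro exI[of _ c]) auto
qed

section \<open>The Liouville theorem in the whole space\<close>

text \<open>The bound holds on balls of every radius, so the gradient vanishes identically. The
  Laplacian then vanishes too, and the equation leaves only the power of \<open>u\<close>.\<close>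

lemma entire_solution_zero:
  fixes u :: "real ^ 'n::finite \<Rightarrow> real"
  assumes p: "p > 1" "q = 2 * p / (p + 1)"
    and M: "M > M_dagger CARD('n) p"
    and sol: "classical_solution p q M UNIV u" and nonneg: "\<And>x. u x \<ge> 0"
  shows "u x = 0"
proof -
  define \<alpha> where "\<alpha> = (p + 1) / (p - 1)"
  define A where "A = 2 / CARD('n) * (M\<^sup>2 - (M_dagger CARD('n) p)\<^sup>2)"
  define K where "K = (q * M)\<^sup>2 / A"
  define k where "k = 2 * \<alpha>"
  define C where "C = (1 + (2 * k * CARD('n) + 4 * k * (k + 1)) + 2 * k * sqrt K) / sqrt A"
  have \<alpha>: "\<alpha> > 0" and k: "k > 0" using p by (simp_all add: \<alpha>_def k_def)
  have "A > 0"
    unfolding A_def using M M_dagger_pos[of p "CARD('n)"] p by (simp add: power_strict_mono)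
  then have K: "(q * M)\<^sup>2 \<le> K * A" "K \<ge> 0" by (auto simp: K_def)
  have "C > 0"
    unfolding C_def using k K \<open>A > 0\<close> by (intro divide_pos_pos add_pos_nonneg) auto
  have bound: "norm (gradient u a) \<le> (C / R) powr \<alpha>" if "R > 0" for a R
    using gradient_bound_ball[OF p M sol open_UNIV nonneg that _ A_def K k_def[unfolded \<alpha>_def], of a]
    by (simp add: C_def \<alpha>_def)
  have grad: "gradient u a = 0" for a
  proof (rule ccontr)
    assume "gradient u a \<noteq> 0"
    then have g: "norm (gradient u a) > 0" by simp
    \<comment> \<open>With radius \<open>2 * C / r\<close> the bound reads
      \<open>(r / 2) powr \<alpha>\<close>, strictly less than \<open>r powr \<alpha>\<close>, which
      is the gradient norm itself.\<close>
    define r where "r = norm (gradient u a) powr (1 / \<alpha>)"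
    have "r > 0" using g by (simp add: r_def)
    then have "norm (gradient u a) \<le> (C / (2 * C / r)) powr \<alpha>"
      using bound[of "2 * C / r" a] \<open>C > 0\<close> by simp
    also have "\<dots> = (r / 2) powr \<alpha>" using \<open>C > 0\<close> by simp
    also have "\<dots> < r powr \<alpha>" using \<open>r > 0\<close> \<alpha> by (intro powr_less_mono2) auto
    also have "\<dots> = norm (gradient u a)" using g \<alpha> by (simp add: r_def powr_powr)
    finally show False by simp
  qed
  have "- laplacian u x = \<bar>u x\<bar> powr (p - 1) * u x + M * norm (gradient u x) powr q"
    using sol by (simp add: classical_solution_def)
  then show ?thesis
    using laplacian_zero_of_gradient_zero[of u x, OF grad] grad by simp
qed

theorem theoremC:
  fixes p q :: real
  assumes "p > 1" and "q = 2 * p / (p + 1)"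
  shows "(\<forall>\<nu>>0. \<exists>c>0. \<forall>M (\<Omega> :: (real ^ 'n::finite) set) u.
            M > M_dagger CARD('n) p \<longrightarrow> (1 - \<nu>) * M > M_dagger CARD('n) p \<longrightarrow>
            open \<Omega> \<longrightarrow> connected \<Omega> \<longrightarrow> frontier \<Omega> \<noteq> {} \<longrightarrow>
            classical_solution p q M \<Omega> u \<longrightarrow> (\<forall>x\<in>\<Omega>. u x > 0) \<longrightarrow>
            (\<forall>x\<in>\<Omega>. norm (gradient u x) \<le>
               c * ((1 - \<nu>) * M - M_dagger CARD('n) p) powr (- ((p + 1) / (p - 1)))
                 * infdist x (frontier \<Omega>) powr (- ((p + 1) / (p - 1)))))
       \<and> (\<forall>M. M > M_dagger CARD('n) p \<longrightarrow>
            \<not> (\<exists>u :: real ^ 'n \<Rightarrow> real.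
                 classical_solution p q M UNIV u \<and> (\<forall>x. u x \<ge> 0) \<and> (\<exists>x. u x \<noteq> 0)))"
  using gradient_estimate[OF assms] entire_solution_zero[OF assms] by blast

end
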